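(* Let $\ell\ge 3$ and let $H$ be an $\ell$-layered acyclic oriented graph with $p(H)\ge 6$. Then $\tau(H)=p(H)$.
   Context: An oriented graph is a directed graph with no loops in which any two vertices are joined by at most one arc; a tournament is an orientation of a complete graph. An acyclic oriented graph $H$ is $\ell$-layered if for every vertex $v$ of $H$ that is neither a sink nor a source there is a pair $(i,j)\in\mathbb Z_\ell^2$ such that the length of every directed path from any source of $H$ to $v$ is congruent to $i$ modulo $\ell$ and the length of every directed path from $v$ to any sink of $H$ is congruent to $j$ modulo $\ell$. A homomorphism $H\to T$ is a map $f:V(H)\to V(T)$ such that $f(u)f(v)$ is an arc of $T$ for every arc $uv$ of $H$. The compressibility $\tau(H)$ is the smallest $k\in\mathbb N$ such that for every tournament $T$ on $k$ vertices there is a homomorphism $H\to T$ ($\infty$ if none exists). $p(H)$ is the maximum number of vertices of a directed path in $H$. *)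

theory Defs
  imports
    "Graph_Theory.Pair_Digraph"
    "Graph_Theory.Vertex_Walk"
    "HOL-Library.Extended_Nat"
    "HOL-Number_Theory.Cong"
begin

locale oriented_graph = pair_digraph H for H :: "'a pair_pre_digraph" +
  assumes at_most_one_arc: "(u, v) \<in> parcs H \<Longrightarrow> (v, u) \<notin> parcs H"

locale tournament = oriented_graph T for T :: "'a pair_pre_digraph" +
  assumes complete: "\<lbrakk>u \<in> pverts T; v \<in> pverts T; u \<noteq> v\<rbrakk> \<Longrightarrow> (u, v) \<in> parcs T \<or> (v, u) \<in> parcs T"

definition is_source :: "'a pair_pre_digraph \<Rightarrow> 'a \<Rightarrow> bool" where
  "is_source H v \<longleftrightarrow> v \<in> pverts H \<and> (\<nexists>u. (u, v) \<in> parcs H)"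

definition is_sink :: "'a pair_pre_digraph \<Rightarrow> 'a \<Rightarrow> bool" where
  "is_sink H v \<longleftrightarrow> v \<in> pverts H \<and> (\<nexists>w. (v, w) \<in> parcs H)"

(* The residues i, j < l represent the elements of Z_l; vwalk_length counts arcs. *)
definition layered :: "nat \<Rightarrow> 'a pair_pre_digraph \<Rightarrow> bool" where
  "layered l H \<longleftrightarrow>
     (\<forall>v \<in> pverts H. \<not> is_sink H v \<and> \<not> is_source H v \<longrightarrow>
        (\<exists>i < l. \<exists>j < l.
           (\<forall>p. vpath p H \<and> is_source H (hd p) \<and> last p = v \<longrightarrow> [vwalk_length p = i] (mod l)) \<and>
           (\<forall>p. vpath p H \<and> hd p = v \<and> is_sink H (last p) \<longrightarrow> [vwalk_length p = j] (mod l))))"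

definition digraph_hom :: "('a \<Rightarrow> 'b) \<Rightarrow> 'a pair_pre_digraph \<Rightarrow> 'b pair_pre_digraph \<Rightarrow> bool" where
  "digraph_hom f H T \<longleftrightarrow>
     f ` pverts H \<subseteq> pverts T \<and> (\<forall>u v. (u, v) \<in> parcs H \<longrightarrow> (f u, f v) \<in> parcs T)"

(* Every finite tournament is isomorphic to one whose vertices are natural numbers.
   The infimum of the empty set of extended naturals is infinity. *)
definition compressibility :: "'a pair_pre_digraph \<Rightarrow> enat" where
  "compressibility H =
     Inf {enat k | k. \<forall>T :: nat pair_pre_digraph.
            tournament T \<and> card (pverts T) = k \<longrightarrow> (\<exists>f. digraph_hom f H T)}"

(* Sup rather than Max: on a finite nonempty set of naturals they agree, but a graph
   without vertices has no vpath, and Sup {} = 0 whereas Max {} is unspecified. *)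
definition longest_path_order :: "'a pair_pre_digraph \<Rightarrow> nat" where
  "longest_path_order H = (SUP p \<in> {p. vpath p H}. length p)"

end

theory Submission
  imports Defs
begin

text \<open>
  Mapping to a transitive tournament shows that fewer than \<open>p(H)\<close> vertices never suffice. Conversely,
  let \<open>T\<close> be a tournament on \<open>p(H) \<ge> 6\<close> vertices. If its vertices split into nonempty \<open>X\<close> and \<open>Y\<close> with
  all arcs from \<open>X\<close> to \<open>Y\<close>, send the non-sinks of depth less than \<open>|X|\<close> to \<open>X\<close> and the rest to \<open>Y\<close>. On
  the two parts depth and height, respectively, change by 1 modulo \<open>l\<close> along every arc, and such a
  graded graph with \<open>n\<close> levels maps to every tournament on \<open>n\<close> vertices: use a Hamiltonian path if
  \<open>n \<le> l\<close>, a closed walk of length \<open>l\<close> if \<open>n > l\<close> and the tournament is strong, and cut again otherwise.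

  If \<open>T\<close> is strong, it has an arc \<open>s \<rightarrow> t\<close> such that for each residue \<open>c\<close> modulo \<open>l\<close> some closed walk of
  length \<open>l\<close> can be entered from \<open>s\<close> and left to \<open>t\<close> along a path of length congruent to \<open>c\<close>. Send
  sources to \<open>s\<close>, sinks to \<open>t\<close>, and each component of inner vertices, on which depth plus height is a
  constant \<open>c\<close> modulo \<open>l\<close>, around the corresponding closed walk. Every 5-vertex strong tournament
  other than the regular one contains such an arc, and a strong tournament on at least 6 vertices has
  a non-regular strong subtournament on 5 vertices.
\<close>

section \<open>Tournaments as relations, and strong connectivity\<close>

definition tournament_on :: "'a set \<Rightarrow> 'a rel \<Rightarrow> bool" where
  "tournament_on V E \<longleftrightarrow> finite V \<and> E \<subseteq> V \<times> V \<and>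
     (\<forall>u \<in> V. \<forall>v \<in> V. (u, v) \<in> E \<longleftrightarrow> u \<noteq> v \<and> (v, u) \<notin> E)"

text \<open>Stated through cuts rather than walks, because the proof uses it only to bring new
  vertices into cycles and, where it fails, to split the vertex set.\<close>

definition strong_on :: "'a set \<Rightarrow> 'a rel \<Rightarrow> bool" where
  "strong_on V E \<longleftrightarrow>
     (\<forall>X. X \<subseteq> V \<and> X \<noteq> {} \<and> X \<noteq> V \<longrightarrow> (\<exists>y \<in> V - X. \<exists>x \<in> X. (y, x) \<in> E))"

lemma tournament_onD:
  assumes "tournament_on V E"
  shows "(u, v) \<in> E \<Longrightarrow> u \<in> V" "(u, v) \<in> E \<Longrightarrow> v \<in> V" "(u, v) \<in> E \<Longrightarrow> (v, u) \<notin> E"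
    "(u, u) \<notin> E" "u \<in> V \<Longrightarrow> v \<in> V \<Longrightarrow> u \<noteq> v \<Longrightarrow> (u, v) \<in> E \<or> (v, u) \<in> E"
  using assms unfolding tournament_on_def by blast+

lemma tournament_on_Restr:
  assumes "tournament_on V E" "X \<subseteq> V"
  shows "tournament_on X (Restr E X)"
  using assms unfolding tournament_on_def by (auto intro: finite_subset)

lemma not_strong_cut:
  assumes "tournament_on V E" "\<not> strong_on V E"
  obtains X Y where "X \<noteq> {}" "Y \<noteq> {}" "X \<inter> Y = {}" "V = X \<union> Y" "X \<times> Y \<subseteq> E"
proof -
  obtain X where X: "X \<subseteq> V" "X \<noteq> {}" "X \<noteq> V" "\<forall>y \<in> V - X. \<forall>x \<in> X. (y, x) \<notin> E"
    using assms(2) unfolding strong_on_def by blast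
  show thesis
  proof (rule that[of X "V - X"])
    show "X \<times> (V - X) \<subseteq> E" using X tournament_onD(5)[OF assms(1)] by blast
  qed (use X in auto)
qed

section \<open>Short cycles and closed walks in strong tournaments\<close>

text \<open>If the first alternative fails, each outside vertex dominates \<open>C\<close> or is
  dominated by it, and strongness gives an arc from a dominated to a dominating vertex. When
  \<open>C\<close> is a cycle, the first alternative allows \<open>v\<close> to be inserted and the
  second allows a detour through \<open>y\<close> and \<open>x\<close>.\<close>

lemma strong_extend:
  assumes T: "tournament_on V E" "strong_on V E" and C: "C \<subseteq> V" "C \<noteq> {}" "C \<noteq> V"
  shows "(\<exists>v \<in> V - C. (\<exists>c \<in> C. (c, v) \<in> E) \<and> (\<exists>c \<in> C. (v, c) \<in> E)) \<or>
    (\<exists>y \<in> V - C. \<exists>x \<in> V - C. (y, x) \<in> E \<and> (\<forall>c \<in> C. (c, y) \<in> E \<and> (x, c) \<in> E))"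
proof (cases "\<exists>v \<in> V - C. (\<exists>c \<in> C. (c, v) \<in> E) \<and> (\<exists>c \<in> C. (v, c) \<in> E)")
  case False
  define X where "X = {x \<in> V - C. \<forall>c \<in> C. (x, c) \<in> E}"
  have Y: "\<forall>c \<in> C. (c, y) \<in> E" if "y \<in> V - C" "y \<notin> X" for y
    using False that tournament_onD(5)[OF T(1)] C unfolding X_def by blast
  obtain z c where "z \<in> V - C" "c \<in> C" "(z, c) \<in> E"
    using T(2) C unfolding strong_on_def by blast
  then have "X \<noteq> {}" using Y tournament_onD(3)[OF T(1)] by blast
  moreover have "X \<subseteq> V" "X \<noteq> V" using C unfolding X_def by auto
  ultimately obtain y x where yx: "y \<in> V - X" "x \<in> X" "(y, x) \<in> E"
    using T(2) unfolding strong_on_def by blast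
  then have "y \<notin> C" using tournament_onD(3)[OF T(1)] unfolding X_def by blast
  then show ?thesis using yx Y[of y] unfolding X_def by blast
qed simp

lemma strong_3_cycle:
  assumes T: "tournament_on V E" "strong_on V E" and "card V \<ge> 3"
  obtains a b c where "(a, b) \<in> E" "(b, c) \<in> E" "(c, a) \<in> E"
proof -
  obtain a where "a \<in> V" using assms(3) by (cases "V = {}") auto
  moreover have "{a} \<noteq> V" using assms(3) by auto
  ultimately show thesis
    using strong_extend[OF T, of "{a}"] that tournament_onD(3)[OF T(1)] by blast
qed

lemma strong_4_cycle:
  assumes T: "tournament_on V E" "strong_on V E" and "card V \<ge> 4"
  obtains a b c d where "(a, b) \<in> E" "(b, c) \<in> E" "(c, d) \<in> E" "(d, a) \<in> E"
proof -
  have "card V \<ge> 3" using assms(3) by simp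
  then obtain a b c where C: "(a, b) \<in> E" "(b, c) \<in> E" "(c, a) \<in> E"
    using strong_3_cycle[OF T] by blast
  have "card {a, b, c} \<le> 3" by (simp add: card_insert_if)
  then have "{a, b, c} \<noteq> V" using assms(3) by auto
  moreover have V: "{a, b, c} \<subseteq> V" using C tournament_onD[OF T(1)] by blast
  ultimately consider v where "v \<in> V - {a, b, c}"
      "\<exists>c \<in> {a, b, c}. (c, v) \<in> E" "\<exists>c \<in> {a, b, c}. (v, c) \<in> E"
    | y x where "(y, x) \<in> E" "\<forall>c \<in> {a, b, c}. (c, y) \<in> E \<and> (x, c) \<in> E"
    using strong_extend[OF T, of "{a, b, c}"] by blast
  then show thesis
  proof cases
    case 1
    \<comment> \<open>Around the cycle, the arcs at \<open>v\<close> must change somewhere from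
      entering to leaving \<open>v\<close>; there \<open>v\<close> fits between consecutive
      vertices.\<close>
    then have "(a, v) \<in> E \<and> (v, b) \<in> E \<or> (b, v) \<in> E \<and> (v, c) \<in> E \<or> (c, v) \<in> E \<and> (v, a) \<in> E"
      using V tournament_onD(5)[OF T(1), of v] by blast
    then show thesis using C that by blast
  next
    case 2
    then show thesis using C that[of a y x c] by blast
  qed
qed

lemma strong_5_cycle:
  assumes T: "tournament_on V E" "strong_on V E" and "card V \<ge> 5"
  obtains a b c d e where
    "(a, b) \<in> E" "(b, c) \<in> E" "(c, d) \<in> E" "(d, e) \<in> E" "(e, a) \<in> E"
proof -
  have "card V \<ge> 4" using assms(3) by simp
  then obtain a b c d where C: "(a, b) \<in> E" "(b, c) \<in> E" "(c, d) \<in> E" "(d, a) \<in> E"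
    using strong_4_cycle[OF T] by blast
  have "card {a, b, c, d} \<le> 4" by (simp add: card_insert_if)
  then have "{a, b, c, d} \<noteq> V" using assms(3) by auto
  moreover have V: "{a, b, c, d} \<subseteq> V" using C tournament_onD[OF T(1)] by blast
  ultimately consider v where "v \<in> V - {a, b, c, d}"
      "\<exists>c \<in> {a, b, c, d}. (c, v) \<in> E" "\<exists>c \<in> {a, b, c, d}. (v, c) \<in> E"
    | y x where "(y, x) \<in> E" "\<forall>c \<in> {a, b, c, d}. (c, y) \<in> E \<and> (x, c) \<in> E"
    using strong_extend[OF T, of "{a, b, c, d}"] by blast
  then show thesis
  proof cases
    case 1
    then have "(a, v) \<in> E \<and> (v, b) \<in> E \<or> (b, v) \<in> E \<and> (v, c) \<in> E \<or>
        (c, v) \<in> E \<and> (v, d) \<in> E \<or> (d, v) \<in> E \<and> (v, a) \<in> E"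
      using V tournament_onD(5)[OF T(1), of v] by blast
    then show thesis using C that by blast
  next
    case 2
    then show thesis using C that[of a y x c d] by blast
  qed
qed

lemma relpow_paths:
  "(a, a) \<in> E ^^ 0"
  "(a, b) \<in> E \<Longrightarrow> (a, b) \<in> E ^^ 1"
  "(a, b) \<in> E \<Longrightarrow> (b, c) \<in> E \<Longrightarrow> (a, c) \<in> E ^^ 2"
  "(a, b) \<in> E \<Longrightarrow> (b, c) \<in> E \<Longrightarrow> (c, d) \<in> E \<Longrightarrow> (a, d) \<in> E ^^ 3"
  "(a, b) \<in> E \<Longrightarrow> (b, c) \<in> E \<Longrightarrow> (c, d) \<in> E \<Longrightarrow> (d, e) \<in> E \<Longrightarrow> (a, e) \<in> E ^^ 4"
  "(a, b) \<in> E \<Longrightarrow> (b, c) \<in> E \<Longrightarrow> (c, d) \<in> E \<Longrightarrow> (d, e) \<in> E \<Longrightarrow> (e, f) \<in> E \<Longrightarrow>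
    (a, f) \<in> E ^^ 5"
  by (auto simp: eval_nat_numeral)

text \<open>A diagonal of a 4-cycle splits off a triangle through \<open>a\<close>, so
  \<open>a\<close> has closed walks of lengths 3 and 4, and their sums give every length from 6 on.
  Length 5 needs its own cycle, and length 3 is treated apart because \<open>V\<close> may have only
  3 vertices.\<close>

lemma strong_closed_walk:
  assumes T: "tournament_on V E" "strong_on V E" and l: "3 \<le> l" "l \<le> card V"
  obtains a where "(a, a) \<in> E ^^ l"
proof -
  consider "l = 3" | "l = 5" | "l = 4 \<or> l \<ge> 6" using l(1) by linarith
  then show thesis
  proof cases
    case 1
    then have "card V \<ge> 3" using l by simp
    then obtain a b c where "(a, b) \<in> E" "(b, c) \<in> E" "(c, a) \<in> E"
      using strong_3_cycle[OF T] by blast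
    then show thesis using that[of a] relpow_paths(4)[of a b E c a] 1 by simp
  next
    case 2
    then have "card V \<ge> 5" using l by simp
    then obtain a b c d e where
      "(a, b) \<in> E" "(b, c) \<in> E" "(c, d) \<in> E" "(d, e) \<in> E" "(e, a) \<in> E"
      using strong_5_cycle[OF T] by blast
    then show thesis using that[of a] relpow_paths(6)[of a b E c d e a] 2 by simp
  next
    case 3
    then have "card V \<ge> 4" using l by auto
    then obtain a b c d where C: "(a, b) \<in> E" "(b, c) \<in> E" "(c, d) \<in> E" "(d, a) \<in> E"
      using strong_4_cycle[OF T] by blast
    have "a \<noteq> c" using C tournament_onD(3)[OF T(1)] by blast
    then have "(a, c) \<in> E \<or> (c, a) \<in> E" using C tournament_onD[OF T(1)] by meson
    then have a3: "(a, a) \<in> E ^^ 3" using C relpow_paths(4)[of a _ E _ a] by blast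
    have a4: "(a, a) \<in> E ^^ 4" using C by (rule relpow_paths)
    have "(a, a) \<in> E ^^ n" if "n \<ge> 6" for n
      using that
    proof (induction n rule: less_induct)
      case (less n)
      consider "n = 3 + 3" | "n = 3 + 4" | "n = 4 + 4" | "n \<ge> 9"
        using less.prems by linarith
      then show ?case
      proof cases
        case 4
        then have "(a, a) \<in> E ^^ (3 + (n - 3))"
          using less.IH[of "n - 3"] by (intro relpow_trans[OF a3]) simp
        then show ?thesis using 4 by simp
      qed (simp_all only: relpow_trans[OF a3 a3] relpow_trans[OF a3 a4] relpow_trans[OF a4 a4])
    qed
    then show thesis using 3 a4 that by blast
  qed
qed

section \<open>Good arcs\<close>

text \<open>
  Given a good arc from \<open>s\<close> to \<open>t\<close>, for every length at least 3 and every distance there is a closed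
  walk of that length that can be entered from \<open>s\<close> and, at that distance along the walk, left
  towards \<open>t\<close>. Such a walk receives the inner vertices of one component of a layered graph.
\<close>

definition good_arc :: "'a rel \<Rightarrow> 'a \<Rightarrow> 'a \<Rightarrow> bool" where
  "good_arc E s t \<longleftrightarrow> (s, t) \<in> E \<and> (\<forall>d e. 3 \<le> d + e \<longrightarrow>
     (\<exists>x y. (s, x) \<in> E \<and> (y, t) \<in> E \<and> (x, y) \<in> E ^^ d \<and> (y, x) \<in> E ^^ e))"

text \<open>
  Lengths 3, 4 and 5 suffice: a triangle at the entry vertex can be inserted on either side.
\<close>

lemma good_arcI:
  assumes st: "(s, t) \<in> E"
    and c3: "\<exists>a b c. (s,a) \<in> E \<and> (a,t) \<in> E \<and>
        (a,b) \<in> E \<and> (b,c) \<in> E \<and> (c,a) \<in> E"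
      "\<exists>a b c. (s,a) \<in> E \<and> (b,t) \<in> E \<and>
        (a,b) \<in> E \<and> (b,c) \<in> E \<and> (c,a) \<in> E"
      "\<exists>a b c. (s,a) \<in> E \<and> (c,t) \<in> E \<and>
        (a,b) \<in> E \<and> (b,c) \<in> E \<and> (c,a) \<in> E"
    and c4: "\<exists>a b c d. (s,a) \<in> E \<and> (a,t) \<in> E \<and>
        (a,b) \<in> E \<and> (b,c) \<in> E \<and> (c,d) \<in> E \<and> (d,a) \<in> E \<and> P a"
      "\<exists>a b c d. (s,a) \<in> E \<and> (b,t) \<in> E \<and>
        (a,b) \<in> E \<and> (b,c) \<in> E \<and> (c,d) \<in> E \<and> (d,a) \<in> E \<and> P a"
      "\<exists>a b c d. (s,a) \<in> E \<and> (c,t) \<in> E \<and>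
        (a,b) \<in> E \<and> (b,c) \<in> E \<and> (c,d) \<in> E \<and> (d,a) \<in> E \<and> P a"
      "\<exists>a b c d. (s,a) \<in> E \<and> (d,t) \<in> E \<and>
        (a,b) \<in> E \<and> (b,c) \<in> E \<and> (c,d) \<in> E \<and> (d,a) \<in> E \<and> P a"
    and c5: "\<exists>a b c d e. (s,a) \<in> E \<and> (a,t) \<in> E \<and>
        (a,b) \<in> E \<and> (b,c) \<in> E \<and> (c,d) \<in> E \<and> (d,e) \<in> E \<and> (e,a) \<in> E \<and> P a"
      "\<exists>a b c d e. (s,a) \<in> E \<and> (b,t) \<in> E \<and>
        (a,b) \<in> E \<and> (b,c) \<in> E \<and> (c,d) \<in> E \<and> (d,e) \<in> E \<and> (e,a) \<in> E \<and> P a"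
      "\<exists>a b c d e. (s,a) \<in> E \<and> (c,t) \<in> E \<and>
        (a,b) \<in> E \<and> (b,c) \<in> E \<and> (c,d) \<in> E \<and> (d,e) \<in> E \<and> (e,a) \<in> E \<and> P a"
      "\<exists>a b c d e. (s,a) \<in> E \<and> (d,t) \<in> E \<and>
        (a,b) \<in> E \<and> (b,c) \<in> E \<and> (c,d) \<in> E \<and> (d,e) \<in> E \<and> (e,a) \<in> E \<and> P a"
      "\<exists>a b c d e. (s,a) \<in> E \<and> (e,t) \<in> E \<and>
        (a,b) \<in> E \<and> (b,c) \<in> E \<and> (c,d) \<in> E \<and> (d,e) \<in> E \<and> (e,a) \<in> E \<and> P a"
    and P: "\<And>a. P a \<Longrightarrow> \<exists>b c. (a,b) \<in> E \<and> (b,c) \<in> E \<and> (c,a) \<in> E"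
  shows "good_arc E s t"
proof -
  define G where "G d e \<longleftrightarrow> (\<exists>x y. (s,x) \<in> E \<and> (y,t) \<in> E \<and>
      (x,y) \<in> E ^^ d \<and> (y,x) \<in> E ^^ e \<and> (x,x) \<in> E ^^ 3)"
    for d e
  \<comment> \<open>\<open>P\<close> marks vertices known to lie on a triangle, so that the
    assumptions need not exhibit one for each closed walk.\<close>
  have P3: "P a \<Longrightarrow> (a, a) \<in> E ^^ 3" for a using P[of a] relpow_paths(4)[of a _ E _ a] by blast
  have G3: "G 0 3" "G 1 2" "G 2 1"
    using c3 unfolding G_def by (meson relpow_paths)+
  have G4: "G 0 4" "G 1 3" "G 2 2" "G 3 1"
    using c4 P3 unfolding G_def by (meson relpow_paths)+
  have G5: "G 0 5" "G 1 4" "G 2 3" "G 3 2" "G 4 1"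
    using c5 P3 unfolding G_def by (meson relpow_paths)+
  \<comment> \<open>When one of the two walks is empty its ends coincide, so the walks can trade
    places; hence the assumptions omit distances equal to the full length.\<close>
  have G0: "G 0 n \<Longrightarrow> G n 0" for n unfolding G_def by auto
  have shift: "G (3 + d) e" "G d (e + 3)" if de: "G d e" for d e
  proof -
    obtain x y where xy: "(s, x) \<in> E" "(y, t) \<in> E" "(x, y) \<in> E ^^ d" "(y, x) \<in> E ^^ e"
      "(x, x) \<in> E ^^ 3"
      using de unfolding G_def by blast
    show "G (3 + d) e" unfolding G_def using xy relpow_trans[OF xy(5,3)] by blast
    show "G d (e + 3)" unfolding G_def using xy relpow_trans[OF xy(4,5)] by blast
  qed
  have "G d e" if "d + e \<ge> 3" for d e
    using that
  proof (induction "d + e" arbitrary: d e rule: less_induct)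
    case less
    show ?case
    proof (cases "d + e \<ge> 6")
      case True
      show ?thesis
      proof (cases "d \<ge> 3")
        case True
        then show ?thesis using shift(1)[of "d - 3" e] less.hyps[of "d - 3" e] \<open>d + e \<ge> 6\<close> by simp
      next
        case False
        then show ?thesis using shift(2)[of d "e - 3"] less.hyps[of d "e - 3"] \<open>d + e \<ge> 6\<close> by simp
      qed
    next
      case False
      then consider "d + e = 3" | "d + e = 4" | "d + e = 5" using less.prems by linarith
      then show ?thesis
      proof cases
        case 1
        then have "d = 0 \<and> e = 3 \<or> d = 1 \<and> e = 2 \<or> d = 2 \<and> e = 1 \<or> d = 3 \<and> e = 0" by linarith
        then show ?thesis using G3 G0 by blast
      next
        case 2
        then have "d = 0 \<and> e = 4 \<or> d = 1 \<and> e = 3 \<or> d = 2 \<and> e = 2 \<or> d = 3 \<and> e = 1 \<or> d = 4 \<and> e = 0"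
          by linarith
        then show ?thesis using G4 G0 by blast
      next
        case 3
        then have "d = 0 \<and> e = 5 \<or> d = 1 \<and> e = 4 \<or> d = 2 \<and> e = 3 \<or> d = 3 \<and> e = 2 \<or> d = 4 \<and> e = 1 \<or>
          d = 5 \<and> e = 0"
          by linarith
        then show ?thesis using G5 G0 by blast
      qed
    qed
  qed
  then show ?thesis using st unfolding good_arc_def G_def by blast
qed

text \<open>The four cases cover all directions of the three diagonals left open; in each, the
  required closed walks are found by search among the five vertices.\<close>

lemma good_arc_patterns:
  assumes "(a,b) \<in> E" "(b,c) \<in> E" "(c,d) \<in> E" "(d,e) \<in> E" "(e,a) \<in> E" "(a,c) \<in> E" "(d,b) \<in> E"
  shows "(a,d) \<in> E \<Longrightarrow> good_arc E a b"
    "(d,a) \<in> E \<Longrightarrow> (c,e) \<in> E \<Longrightarrow> good_arc E d b"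
    "(e,c) \<in> E \<Longrightarrow> (b,e) \<in> E \<Longrightarrow> good_arc E a c"
    "(d,a) \<in> E \<Longrightarrow> (e,c) \<in> E \<Longrightarrow> (e,b) \<in> E \<Longrightarrow> good_arc E e b"
  using assms by - (rule good_arcI[where P = "\<lambda>x. x \<in> {a,b,c,d,e}"]; blast)+

text \<open>In a regular 5-vertex tournament the diagonals of a Hamiltonian cycle all run the same
  way round, so \<open>diag\<close> excludes it.\<close>

lemma nonregular_5_cycle_good_arc:
  assumes T: "tournament_on V E"
    and cyc: "(a,b) \<in> E" "(b,c) \<in> E" "(c,d) \<in> E" "(d,e) \<in> E" "(e,a) \<in> E"
    and diag: "(a,c) \<in> E" "(d,b) \<in> E"
  shows "\<exists>s t. good_arc E s t"
proof -
  have tot: "(x,y) \<in> E \<or> (y,x) \<in> E" if "(x,z) \<in> E" "(z,y) \<in> E" for x y z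
    using that tournament_onD[OF T] by metis
  have "(a,d) \<in> E \<or> (d,a) \<in> E" "(c,e) \<in> E \<or> (e,c) \<in> E" "(b,e) \<in> E \<or> (e,b) \<in> E"
    using tot cyc by blast+
  then show ?thesis using good_arc_patterns[OF cyc diag] by blast
qed

text \<open>One or two outside vertices replace as many on the cycle, so that the new 5-cycle has a
  forward diagonal followed by a backward one.\<close>

lemma regular_5_tournament_good_arc:
  assumes T: "tournament_on V E" "strong_on V E" and "card V \<ge> 6"
    and cyc: "(a,b) \<in> E" "(b,c) \<in> E" "(c,d) \<in> E" "(d,e) \<in> E" "(e,a) \<in> E"
    and diag: "(a,c) \<in> E" "(b,d) \<in> E" "(c,e) \<in> E" "(d,a) \<in> E" "(e,b) \<in> E"
  shows "\<exists>s t. good_arc E s t"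
proof -
  have "card {a, b, c, d, e} \<le> 5" by (simp add: card_insert_if)
  then have "{a, b, c, d, e} \<noteq> V" using assms(3) by auto
  moreover have V: "{a, b, c, d, e} \<subseteq> V" using cyc tournament_onD[OF T(1)] by blast
  ultimately consider v where "v \<in> V - {a, b, c, d, e}"
      "\<exists>c \<in> {a, b, c, d, e}. (c, v) \<in> E" "\<exists>c \<in> {a, b, c, d, e}. (v, c) \<in> E"
    | y x where "(y, x) \<in> E" "\<forall>c \<in> {a, b, c, d, e}. (c, y) \<in> E \<and> (x, c) \<in> E"
    using strong_extend[OF T, of "{a, b, c, d, e}"] by blast
  then show ?thesis
  proof cases
    case (1 v)
    \<comment> \<open>The fifth cycle vertex is bypassed along the diagonal from \<open>c\<close> to
      \<open>e\<close> to make room for \<open>v\<close> between \<open>a\<close> and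
      \<open>b\<close>.\<close>
    have insert: "\<exists>s t. good_arc E s t"
      if "(a,v) \<in> E" "(v,b) \<in> E" "(b,c) \<in> E" "(c,e) \<in> E" "(e,a) \<in> E" "(a,b) \<in> E" "(e,b) \<in> E"
      for a b c e
    proof -
      have "(v,c) \<in> E \<or> (c,v) \<in> E"
        using that tournament_onD[OF T(1)] by metis
      then show ?thesis
      proof
        assume "(v,c) \<in> E"
        then show ?thesis
          using nonregular_5_cycle_good_arc[OF T(1), of v b c e a] that by blast
      next
        assume "(c,v) \<in> E"
        then show ?thesis
          using nonregular_5_cycle_good_arc[OF T(1), of a v b c e] that by blast
      qed
    qed
    have "(a,v) \<in> E \<and> (v,b) \<in> E \<or> (b,v) \<in> E \<and> (v,c) \<in> E \<or> (c,v) \<in> E \<and> (v,d) \<in> E \<or>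
        (d,v) \<in> E \<and> (v,e) \<in> E \<or> (e,v) \<in> E \<and> (v,a) \<in> E"
      using 1 V tournament_onD(5)[OF T(1), of v] by blast
    then show ?thesis
      using insert[of a b c e] insert[of b c d a] insert[of c d e b] insert[of d e a c]
        insert[of e a b d] cyc diag by argo
  next
    case (2 y x)
    then show ?thesis
      using nonregular_5_cycle_good_arc[OF T(1), of x c d a y] cyc diag by blast
  qed
qed

lemma strong_good_arc:
  assumes T: "tournament_on V E" "strong_on V E" and "card V \<ge> 6"
  obtains s t where "good_arc E s t"
proof -
  have "card V \<ge> 5" using assms(3) by simp
  then obtain a b c d e where
    cyc: "(a,b) \<in> E" "(b,c) \<in> E" "(c,d) \<in> E" "(d,e) \<in> E" "(e,a) \<in> E"
    using strong_5_cycle[OF T] by blast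
  have tot: "(x,y) \<in> E \<or> (y,x) \<in> E" if "(x,z) \<in> E" "(z,y) \<in> E" for x y z
    using that tournament_onD[OF T(1)] by metis
  have D: "(a,c) \<in> E \<or> (c,a) \<in> E" "(b,d) \<in> E \<or> (d,b) \<in> E" "(c,e) \<in> E \<or> (e,c) \<in> E"
    "(d,a) \<in> E \<or> (a,d) \<in> E" "(e,b) \<in> E \<or> (b,e) \<in> E"
    using tot cyc by blast+
  \<comment> \<open>If no forward diagonal is followed by a backward one, then all five agree.\<close>
  note N = nonregular_5_cycle_good_arc[OF T(1)]
  consider "\<exists>s t. good_arc E s t"
    | "(a,c) \<in> E" "(b,d) \<in> E" "(c,e) \<in> E" "(d,a) \<in> E" "(e,b) \<in> E"
    | "(c,a) \<in> E" "(d,b) \<in> E" "(e,c) \<in> E" "(a,d) \<in> E" "(b,e) \<in> E"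
    using D N[of a b c d e] N[of b c d e a] N[of c d e a b] N[of d e a b c] N[of e a b c d] cyc
    by argo
  then have "\<exists>s t. good_arc E s t"
  proof cases
    case 2
    then show ?thesis using regular_5_tournament_good_arc[OF T assms(3) cyc] by blast
  next
    case 3
    \<comment> \<open>The backward diagonals form a 5-cycle themselves, and the arcs of the old
      cycle are its forward diagonals.\<close>
    then show ?thesis using regular_5_tournament_good_arc[OF T assms(3), of a d b e c] cyc by blast
  qed
  then show thesis using that by blast
qed

section \<open>Closed walks as periodic functions\<close>

text \<open>Periodicity lets levels that are controlled only modulo the length of the walk serve as
  indices into it.\<close>

lemma closed_walk_fun:
  assumes "(x, y) \<in> E ^^ d" "(y, x) \<in> E ^^ e" "d + e > 0"
  obtains w :: "nat \<Rightarrow> 'a" where "\<And>k. (w k, w (Suc k)) \<in> E"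
    "\<And>j k. [j = k] (mod (d + e)) \<Longrightarrow> w j = w k" "w 0 = x" "w d = y"
proof -
  obtain f where f: "f 0 = x" "f d = y" "\<And>i. i < d \<Longrightarrow> (f i, f (Suc i)) \<in> E"
    using assms(1) unfolding relpow_fun_conv by blast
  obtain g where g: "g 0 = y" "g e = x" "\<And>i. i < e \<Longrightarrow> (g i, g (Suc i)) \<in> E"
    using assms(2) unfolding relpow_fun_conv by blast
  define h where "h k = (if k < d then f k else g (k - d))" for k
  have h: "(h k, h (Suc k)) \<in> E" if "k < d + e" for k
  proof -
    consider "Suc k < d" | "Suc k = d" | "d \<le> k" by linarith
    then show ?thesis
    proof cases
      case 3
      then have "(g (k - d), g (Suc (k - d))) \<in> E" using g(3) that by simp
      then show ?thesis using 3 by (simp add: h_def Suc_diff_le)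
    next
      case 2
      then show ?thesis using f(3)[of k] f(2) g(1) by (simp add: h_def)
    qed (use f(3)[of k] in \<open>simp add: h_def\<close>)
  qed
  have h0: "h 0 = x" "h (d + e) = x" using f g assms(3) by (auto simp: h_def)
  define w where "w k = h (k mod (d + e))" for k
  have "(w k, w (Suc k)) \<in> E" for k
  proof -
    have "h (Suc (k mod (d + e))) = w (Suc k)"
      using h0 by (auto simp: w_def mod_Suc)
    then show ?thesis using h[of "k mod (d + e)"] assms(3) by (auto simp: w_def)
  qed
  moreover have "w j = w k" if "[j = k] (mod (d + e))" for j k
    using that by (simp add: w_def cong_def)
  moreover have "w 0 = x" using h0 by (simp add: w_def)
  moreover have "w d = y"
    \<comment> \<open>For \<open>e = 0\<close> the index \<open>d\<close> wraps to 0, which is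
      harmless because then \<open>x = y\<close>.\<close>
    using f g h0 by (cases "e = 0") (auto simp: w_def h_def)
  ultimately show thesis using that by blast
qed

text \<open>Indices play the role of depths modulo \<open>l\<close>: inner out-neighbours of sources
  have depth 1 and, with \<open>c\<close> standing for depth plus height, inner in-neighbours of
  sinks have depth \<open>c - 1\<close>.\<close>

lemma good_arc_closed_walk:
  assumes "good_arc E s t" "l \<ge> 3"
  shows "\<exists>w :: nat \<Rightarrow> 'a. (\<forall>k. (w k, w (Suc k)) \<in> E) \<and> (\<forall>j k. [j = k] (mod l) \<longrightarrow> w j = w k) \<and>
    (\<forall>k. [k = 1] (mod l) \<longrightarrow> (s, w k) \<in> E) \<and> (\<forall>k. [Suc k = c] (mod l) \<longrightarrow> (w k, t) \<in> E)"
proof -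
  \<comment> \<open>The distance from entry index 1 to exit index \<open>c - 1\<close> is
    \<open>c - 2\<close>; adding \<open>l - 2\<close> avoids truncated subtraction.\<close>
  define d where "d = (c + (l - 2)) mod l"
  have dl: "d < l" "d + (l - d) = l" using assms(2) by (simp_all add: d_def less_imp_le)
  then obtain x y where xy: "(s, x) \<in> E" "(y, t) \<in> E" "(x, y) \<in> E ^^ d" "(y, x) \<in> E ^^ (l - d)"
    using assms unfolding good_arc_def by metis
  obtain w where w: "\<And>k. (w k, w (Suc k)) \<in> E"
    "\<And>j k. [j = k] (mod l) \<Longrightarrow> w j = w k" "w 0 = x" "w d = y"
    using closed_walk_fun[OF xy(3,4)] dl assms(2) by (metis not_numeral_le_zero gr0I)
  show ?thesis
  \<comment> \<open>Adding \<open>l - 1\<close> moves \<open>x\<close> from index 0 to index 1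
    modulo \<open>l\<close>.\<close>
  proof (intro exI[of _ "\<lambda>k. w (k + (l - 1))"] conjI allI impI)
    show "(w (k + (l - 1)), w (Suc k + (l - 1))) \<in> E" for k using w(1) by simp
    show "w (j + (l - 1)) = w (k + (l - 1))" if "[j = k] (mod l)" for j k
      using that by (intro w(2) cong_add cong_refl)
    show "(s, w (k + (l - 1))) \<in> E" if "[k = 1] (mod l)" for k
    proof -
      have "[k + (l - 1) = 1 + (l - 1)] (mod l)" using that by (intro cong_add cong_refl)
      then have "[k + (l - 1) = 0] (mod l)" using assms(2) by (simp add: cong_def)
      then show ?thesis using w(2)[of "k + (l - 1)" 0] w(3) xy(1) by simp
    qed
    show "(w (k + (l - 1)), t) \<in> E" if "[Suc k = c] (mod l)" for k
    proof -
      have "[Suc k + (l - 2) = c + (l - 2)] (mod l)" using that by (intro cong_add cong_refl)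
      moreover have "Suc k + (l - 2) = k + (l - 1)" using assms(2) by simp
      ultimately have "[k + (l - 1) = c + (l - 2)] (mod l)" by (simp only:)
      then have "[k + (l - 1) = d] (mod l)" unfolding d_def by (simp only: cong_mod_right)
      then show ?thesis using w(2)[of "k + (l - 1)" d] w(4) xy(2) by simp
    qed
  qed
qed

section \<open>Homomorphisms from graded graphs\<close>

text \<open>Redei's theorem: the in-neighbours of a chosen vertex are placed before it and all other
  vertices after it.\<close>

lemma Hamiltonian_path:
  assumes "finite V" "\<And>u v. u \<in> V \<Longrightarrow> v \<in> V \<Longrightarrow> u \<noteq> v \<Longrightarrow> (u, v) \<in> E \<or> (v, u) \<in> E"
  shows "\<exists>xs. set xs = V \<and> distinct xs \<and> successively (\<lambda>u v. (u, v) \<in> E) xs"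
  using assms
proof (induction V rule: finite_psubset_induct)
  case (psubset V)
  show ?case
  proof (cases "V = {}")
    case False
    then obtain v where v: "v \<in> V" by blast
    define P where "P = {u \<in> V - {v}. (u, v) \<in> E}"
    define Q where "Q = V - {v} - P"
    have PQ: "P \<subset> V" "Q \<subset> V" using v by (auto simp: P_def Q_def)
    obtain ps where ps: "set ps = P" "distinct ps" "successively (\<lambda>u v. (u, v) \<in> E) ps"
      using psubset.IH[OF PQ(1)] psubset.prems PQ(1) by blast
    obtain qs where qs: "set qs = Q" "distinct qs" "successively (\<lambda>u v. (u, v) \<in> E) qs"
      using psubset.IH[OF PQ(2)] psubset.prems PQ(2) by blast
    have "ps = [] \<or> (last ps, v) \<in> E" using last_in_set[of ps] ps(1) by (auto simp: P_def)
    moreover have "qs = [] \<or> (v, hd qs) \<in> E"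
      using hd_in_set[of qs] qs(1) psubset.prems[of v "hd qs"] v by (auto simp: P_def Q_def)
    ultimately have "successively (\<lambda>u v. (u, v) \<in> E) (ps @ v # qs)"
      using ps qs by (simp add: successively_append_iff successively_Cons)
    moreover have "set (ps @ v # qs) = V" "distinct (ps @ v # qs)"
      using ps qs v by (auto simp: P_def Q_def)
    ultimately show ?thesis by blast
  qed (auto intro: exI[of _ "[]"])
qed

text \<open>
  If there are at most \<open>l\<close> levels, then every arc climbs exactly one level, so a Hamiltonian path
  suffices and the tournament need not be strong.
\<close>

lemma graded_hom:
  fixes R :: "'a rel" and E :: "'b rel" and lv :: "'a \<Rightarrow> nat"
  assumes "tournament_on V E" "l \<ge> 3" "\<And>x. x \<in> S \<Longrightarrow> lv x < card V"
    and "\<And>x y. x \<in> S \<Longrightarrow> y \<in> S \<Longrightarrow> (x, y) \<in> R \<Longrightarrow> lv x < lv y \<and> [lv y = Suc (lv x)] (mod l)"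
  shows "\<exists>f. f ` S \<subseteq> V \<and> (\<forall>x \<in> S. \<forall>y \<in> S. (x, y) \<in> R \<longrightarrow> (f x, f y) \<in> E)"
  using assms
proof (induction "card V" arbitrary: V E S lv rule: less_induct)
  case less
  note T = less.prems(1)
  have fin: "finite V" using T by (simp add: tournament_on_def)
  consider "card V \<le> l" | "card V > l" "strong_on V E" | "\<not> strong_on V E" by linarith
  then show ?case
  proof cases
    case 1
    obtain xs where xs: "set xs = V" "distinct xs" "successively (\<lambda>u v. (u, v) \<in> E) xs"
      using Hamiltonian_path[OF fin tournament_onD(5)[OF T]] by blast
    have len: "length xs = card V" using xs distinct_card by metis
    have "(xs ! lv x, xs ! lv y) \<in> E" if xy: "x \<in> S" "y \<in> S" "(x, y) \<in> R" for x y
    proof -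
      have lt: "lv x < lv y" "lv y < card V" and c: "[lv y = Suc (lv x)] (mod l)"
        using xy less.prems(3,4) by blast+
      obtain r where r: "lv y = Suc (lv x) + r" using less_imp_Suc_add[OF lt(1)] by auto
      then have "[r = 0] (mod l)" using c by (metis cong_add_lcancel_0_nat)
      moreover have "r < l" using lt r 1 by linarith
      ultimately have "r = 0" by (simp add: cong_def)
      then show ?thesis using xs(3) r lt len by (simp add: successively_conv_nth)
    qed
    moreover have "xs ! lv x \<in> V" if "x \<in> S" for x
      using less.prems(3)[OF that] len xs(1) nth_mem by metis
    ultimately show ?thesis by (intro exI[of _ "\<lambda>x. xs ! lv x"]) blast
  next
    case 2
    then obtain a where a: "(a, a) \<in> E ^^ l"
      using strong_closed_walk[OF T 2(2) less.prems(2)] by (meson less_imp_le)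
    have "0 + l > 0" using less.prems(2) by simp
    then obtain w where w: "\<And>k. (w k, w (Suc k)) \<in> E"
      "\<And>j k. [j = k] (mod (0 + l)) \<Longrightarrow> w j = w k"
      using closed_walk_fun[OF relpow_0_I a] by blast
    have "(w (lv x), w (lv y)) \<in> E" if "x \<in> S" "y \<in> S" "(x, y) \<in> R" for x y
      using w(1)[of "lv x"] w(2)[of "lv y" "Suc (lv x)"] less.prems(4)[OF that] by simp
    moreover have "w k \<in> V" for k using w(1) tournament_onD(1)[OF T] by blast
    ultimately show ?thesis by (intro exI[of _ "\<lambda>x. w (lv x)"]) blast
  next
    case 3
    then obtain X Y where XY: "X \<noteq> {}" "Y \<noteq> {}" "X \<inter> Y = {}" "V = X \<union> Y" "X \<times> Y \<subseteq> E"
      using not_strong_cut[OF T] by blast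
    have card: "card V = card X + card Y" "card X > 0" "card Y > 0"
      using XY fin by (auto simp: card_Un_disjoint card_gt_0_iff)
    \<comment> \<open>The lowest \<open>card X\<close> levels go to \<open>X\<close>, the other
      \<open>card Y\<close> to \<open>Y\<close>. Levels rise along arcs, so no arc leads from the
      upper part to the lower.\<close>
    define S1 where "S1 = {x \<in> S. lv x < card X}"
    have "\<exists>f. f ` S1 \<subseteq> X \<and> (\<forall>x \<in> S1. \<forall>y \<in> S1. (x, y) \<in> R \<longrightarrow> (f x, f y) \<in> Restr E X)"
    proof (intro less.hyps[where lv = lv] tournament_on_Restr[OF T] less.prems(2))
      show "card X < card V" "X \<subseteq> V" using card XY(4) by auto
    next
      fix x y assume "x \<in> S1" "y \<in> S1" "(x, y) \<in> R"
      then show "lv x < lv y \<and> [lv y = Suc (lv x)] (mod l)" using less.prems(4) by (simp add: S1_def)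
    qed (simp add: S1_def)
    then obtain f where f: "f ` S1 \<subseteq> X"
      "\<forall>x \<in> S1. \<forall>y \<in> S1. (x, y) \<in> R \<longrightarrow> (f x, f y) \<in> Restr E X" by blast
    have "\<exists>f. f ` (S - S1) \<subseteq> Y \<and>
        (\<forall>x \<in> S - S1. \<forall>y \<in> S - S1. (x, y) \<in> R \<longrightarrow> (f x, f y) \<in> Restr E Y)"
    proof (intro less.hyps[where lv = "\<lambda>x. lv x - card X"] tournament_on_Restr[OF T]
        less.prems(2))
      show "card Y < card V" "Y \<subseteq> V" using card XY(4) by auto
    next
      fix x y assume xy: "x \<in> S - S1" "y \<in> S - S1" "(x, y) \<in> R"
      then have ge: "card X \<le> lv x" and lt: "lv x < lv y" and c: "[lv y = Suc (lv x)] (mod l)"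
        using less.prems(4) by (auto simp: S1_def)
      have "[card X + (lv y - card X) = card X + Suc (lv x - card X)] (mod l)"
        using ge lt c by simp
      then show "lv x - card X < lv y - card X \<and> [lv y - card X = Suc (lv x - card X)] (mod l)"
        using ge lt by (simp only: cong_add_lcancel_nat) simp
    next
      fix x assume "x \<in> S - S1"
      then show "lv x - card X < card Y" using less.prems(3)[of x] card by (auto simp: S1_def)
    qed
    then obtain g where g: "g ` (S - S1) \<subseteq> Y"
      "\<forall>x \<in> S - S1. \<forall>y \<in> S - S1. (x, y) \<in> R \<longrightarrow> (g x, g y) \<in> Restr E Y" by blast
    define h where "h x = (if x \<in> S1 then f x else g x)" for x
    have "(h x, h y) \<in> E" if xy: "x \<in> S" "y \<in> S" "(x, y) \<in> R" for x y
    proof -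
      consider "x \<in> S1" "y \<in> S1" | "x \<notin> S1" "y \<notin> S1" | "x \<in> S1" "y \<notin> S1"
        using xy less.prems(4)[OF xy] by (auto simp: S1_def)
      then show ?thesis
      proof cases
        case 3
        then have "(f x, g y) \<in> X \<times> Y" using xy f(1) g(1) by blast
        then show ?thesis using 3 XY(5) unfolding h_def by auto
      qed (use xy f(2) g(2) in \<open>auto simp: h_def\<close>)
    qed
    moreover have "h ` S \<subseteq> V" using f(1) g(1) XY(4) unfolding h_def by auto
    ultimately show ?thesis by blast
  qed
qed

section \<open>Depth in finite acyclic relations\<close>

text \<open>Applied to the converse relation this is the height, so every fact about depth serves
  for both.\<close>

definition depth :: "'a rel \<Rightarrow> 'a \<Rightarrow> nat" where
  "depth R v = Max {n. \<exists>u. (u, v) \<in> R ^^ n}"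

text \<open>
  An \<open>l\<close>-layered graph is one whose arc relation and its converse are both \<open>l\<close>-graded from the
  sources.
\<close>

definition source_graded :: "nat \<Rightarrow> 'a rel \<Rightarrow> bool" where
  "source_graded l R \<longleftrightarrow> (\<forall>v \<in> Domain R \<inter> Range R. \<exists>i.
     \<forall>u n. u \<notin> Range R \<and> (u, v) \<in> R ^^ n \<longrightarrow> [n = i] (mod l))"

context
  fixes R :: "'a rel"
  assumes R: "finite R" "acyclic R"
begin

text \<open>A nonempty walk into \<open>v\<close> extends a walk into one of finitely many
  predecessors. Finiteness is what gives \<open>Max\<close> in \<open>depth\<close> a
  meaning.\<close>

lemma finite_walk_lengths: "finite {n. \<exists>u. (u, v) \<in> R ^^ n}"
proof -
  have "wf R" using R by (rule finite_acyclic_wf)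
  then show ?thesis
  proof (induction v rule: wf_induct_rule)
    case (less v)
    have "finite {u. (u, v) \<in> R}"
      by (rule finite_subset[OF _ finite_Domain[OF R(1)]]) blast
    then have "finite (insert 0 (Suc ` (\<Union>x \<in> {u. (u, v) \<in> R}. {n. \<exists>u. (u, x) \<in> R ^^ n})))"
      using less by auto
    moreover have "{n. \<exists>u. (u, v) \<in> R ^^ n} \<subseteq>
        insert 0 (Suc ` (\<Union>x \<in> {u. (u, v) \<in> R}. {n. \<exists>u. (u, x) \<in> R ^^ n}))"
    proof
      fix n assume "n \<in> {n. \<exists>u. (u, v) \<in> R ^^ n}"
      then show "n \<in> insert 0 (Suc ` (\<Union>x \<in> {u. (u, v) \<in> R}. {n. \<exists>u. (u, x) \<in> R ^^ n}))"
        by (cases n) (auto elim!: relpow_Suc_E)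
    qed
    ultimately show ?case by (rule rev_finite_subset)
  qed
qed

lemma le_depth: "(u, v) \<in> R ^^ n \<Longrightarrow> n \<le> depth R v"
  unfolding depth_def using finite_walk_lengths by (auto intro!: Max_ge)

text \<open>A longest walk cannot be prolonged backwards, so it starts at a source and
  \<open>source_graded\<close> applies to it.\<close>

lemma depth_walk:
  obtains u where "(u, v) \<in> R ^^ depth R v" "u \<notin> Range R"
proof -
  have "\<exists>u. (u, v) \<in> R ^^ 0" by auto
  then have "{n. \<exists>u. (u, v) \<in> R ^^ n} \<noteq> {}" by blast
  then have "depth R v \<in> {n. \<exists>u. (u, v) \<in> R ^^ n}"
    unfolding depth_def using finite_walk_lengths by (intro Max_in)
  then obtain u where u: "(u, v) \<in> R ^^ depth R v" by blast
  have "u \<notin> Range R"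
  proof
    assume "u \<in> Range R"
    then obtain x where "(x, u) \<in> R" by blast
    then have "(x, v) \<in> R ^^ Suc (depth R v)" using u by (rule relpow_Suc_I2)
    then show False using le_depth by fastforce
  qed
  then show thesis using that u by blast
qed

lemma depth_less: "(u, v) \<in> R \<Longrightarrow> depth R u < depth R v"
proof -
  assume uv: "(u, v) \<in> R"
  obtain x where "(x, u) \<in> R ^^ depth R u" by (rule depth_walk)
  then have "(x, v) \<in> R ^^ Suc (depth R u)" using uv by (rule relpow_Suc_I)
  then show ?thesis using le_depth by fastforce
qed

lemma depth_source:
  assumes "v \<notin> Range R"
  shows "depth R v = 0"
proof -
  obtain u where "(u, v) \<in> R ^^ depth R v" by (rule depth_walk)
  then show ?thesis using assms by (cases "depth R v") (auto elim: relpow_Suc_E)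
qed

text \<open>A longest walk into \<open>u\<close> prolonged by the arc and a longest walk into
  \<open>v\<close> both lead from sources to the inner vertex \<open>v\<close>, so their lengths
  agree modulo \<open>l\<close>. At a sink no such agreement is guaranteed.\<close>

lemma depth_Suc_cong:
  assumes "source_graded l R" "(u, v) \<in> R" "v \<in> Domain R"
  shows "[depth R v = Suc (depth R u)] (mod l)"
proof -
  obtain x where x: "(x, v) \<in> R ^^ depth R v" "x \<notin> Range R" by (rule depth_walk)
  obtain y where y: "(y, u) \<in> R ^^ depth R u" "y \<notin> Range R" by (rule depth_walk)
  have "(y, v) \<in> R ^^ Suc (depth R u)" using y(1) assms(2) by (rule relpow_Suc_I)
  moreover obtain i where "\<And>u n. u \<notin> Range R \<Longrightarrow> (u, v) \<in> R ^^ n \<Longrightarrow> [n = i] (mod l)"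
    using assms unfolding source_graded_def by blast
  ultimately show ?thesis using x y(2) cong_sym cong_trans by metis
qed

end

section \<open>Homomorphisms into strong and into arbitrary tournaments\<close>

lemma hom_into_strong:
  fixes R :: "'a rel" and E :: "'b rel"
  assumes R: "finite R" "acyclic R" and gr: "source_graded l R" "source_graded l (R\<inverse>)"
    and T: "tournament_on V E" "good_arc E s t" "l \<ge> 3"
  shows "\<exists>f. range f \<subseteq> V \<and> (\<forall>x y. (x, y) \<in> R \<longrightarrow> (f x, f y) \<in> E)"
proof -
  have R': "finite (R\<inverse>)" "acyclic (R\<inverse>)" using R by simp_all
  have "\<forall>c. \<exists>w. (\<forall>k. (w k, w (Suc k)) \<in> E) \<and> (\<forall>j k. [j = k] (mod l) \<longrightarrow> w j = w k) \<and>
      (\<forall>k. [k = 1] (mod l) \<longrightarrow> (s, w k) \<in> E) \<and> (\<forall>k. [Suc k = c] (mod l) \<longrightarrow> (w k, t) \<in> E)"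
    (is "\<forall>c. \<exists>w. ?closed c w")
    using good_arc_closed_walk[OF T(2,3)] by (rule allI)
  then have "\<exists>w. \<forall>c. ?closed c (w c)" by (rule choice)
  then obtain w where w': "\<forall>c. ?closed c (w c)" ..
  have w: "\<And>c k. (w c k, w c (Suc k)) \<in> E"
    "\<And>c j k. [j = k] (mod l) \<Longrightarrow> w c j = w c k"
    "\<And>c k. [k = 1] (mod l) \<Longrightarrow> (s, w c k) \<in> E"
    "\<And>c k. [Suc k = c] (mod l) \<Longrightarrow> (w c k, t) \<in> E"
    using w' by blast+
  have st: "(s, t) \<in> E" using T(2) by (simp add: good_arc_def)
  define c where "c v = (depth R v + depth (R\<inverse>) v) mod l" for v
  \<comment> \<open>Isolated vertices, and elements outside the graph, fall under the first branch,
    so \<open>f\<close> is total with values in \<open>V\<close>.\<close>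
  define f where "f v = (if v \<notin> Range R then s else if v \<notin> Domain R then t else w (c v) (depth R v))"
    for v
  have "(f u, f v) \<in> E" if uv: "(u, v) \<in> R" for u v
  proof -
    have dom: "u \<in> Domain R" "v \<in> Range R" using uv by auto
    have d: "[depth R v = Suc (depth R u)] (mod l)" if "v \<in> Domain R"
      using depth_Suc_cong[OF R gr(1) uv that] .
    have h: "[depth (R\<inverse>) u = Suc (depth (R\<inverse>) v)] (mod l)" if "u \<in> Range R"
      using depth_Suc_cong[OF R' gr(2)] uv that by blast
    consider "u \<notin> Range R" "v \<notin> Domain R" | "u \<notin> Range R" "v \<in> Domain R"
      | "u \<in> Range R" "v \<notin> Domain R" | "u \<in> Range R" "v \<in> Domain R" by blast
    then show ?thesis
    proof cases
      case 1
      then show ?thesis using dom st by (simp add: f_def)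
    next
      case 2
      then have "[depth R v = 1] (mod l)" using d depth_source[OF R] by simp
      then show ?thesis using 2 dom w(3) by (simp add: f_def)
    next
      case 3
      then have "depth (R\<inverse>) v = 0" using depth_source[OF R', of v] by simp
      then have "[depth R u + depth (R\<inverse>) u = depth R u + 1] (mod l)"
        using h 3 by (intro cong_add cong_refl) simp
      then have "[Suc (depth R u) = c u] (mod l)"
        unfolding c_def by (simp add: cong_sym_eq)
      then show ?thesis using 3 dom w(4) by (simp add: f_def)
    next
      case 4
      have "[depth R v + depth (R\<inverse>) v = Suc (depth R u) + depth (R\<inverse>) v] (mod l)"
        using d 4 by (intro cong_add cong_refl) simp
      moreover have "[depth R u + depth (R\<inverse>) u = depth R u + Suc (depth (R\<inverse>) v)] (mod l)"
        using h 4 by (intro cong_add cong_refl) simp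
      ultimately have "c v = c u" unfolding c_def cong_def by simp
      then show ?thesis using 4 dom w(1)[of "c u" "depth R u"] w(2)[OF d] by (simp add: f_def)
    qed
  qed
  moreover have "f v \<in> V" for v
    using st w(1) tournament_onD(1,2)[OF T(1)] unfolding f_def by auto
  ultimately show ?thesis by blast
qed

lemma hom_into_tournament:
  fixes R :: "'a rel" and E :: "'b rel"
  assumes R: "finite R" "acyclic R" and gr: "source_graded l R" "source_graded l (R\<inverse>)"
    and T: "tournament_on V E" "card V \<ge> 6" and l: "l \<ge> 3"
    and height: "\<And>v. depth R v + depth (R\<inverse>) v < card V"
  shows "\<exists>f. range f \<subseteq> V \<and> (\<forall>x y. (x, y) \<in> R \<longrightarrow> (f x, f y) \<in> E)"
proof (cases "strong_on V E")
  case True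
  then obtain s t where "good_arc E s t" using strong_good_arc[OF T(1) _ T(2)] by blast
  then show ?thesis using hom_into_strong[OF R gr T(1)] l by blast
next
  case False
  have R': "finite (R\<inverse>)" "acyclic (R\<inverse>)" using R by simp_all
  have fin: "finite V" using T by (simp add: tournament_on_def)
  obtain X Y where XY: "X \<noteq> {}" "Y \<noteq> {}" "X \<inter> Y = {}" "V = X \<union> Y" "X \<times> Y \<subseteq> E"
    using not_strong_cut[OF T(1) False] by blast
  have card: "card V = card X + card Y" "card X > 0" "card Y > 0"
    using XY fin by (auto simp: card_Un_disjoint card_gt_0_iff)
  \<comment> \<open>Sinks have unpredictable depths, so they all go to the far side, where vertices are graded by
    their distance to the sinks instead.\<close>
  define S where "S = {v \<in> Domain R. depth R v < card X}"
  have "\<exists>f. f ` S \<subseteq> X \<and> (\<forall>x \<in> S. \<forall>y \<in> S. (x, y) \<in> R \<longrightarrow> (f x, f y) \<in> Restr E X)"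
  proof (intro graded_hom[where lv = "depth R" and l = l] tournament_on_Restr[OF T(1)] l)
    show "X \<subseteq> V" using XY(4) by blast
  next
    fix x y assume "x \<in> S" "y \<in> S" "(x, y) \<in> R"
    then show "depth R x < depth R y \<and> [depth R y = Suc (depth R x)] (mod l)"
      using depth_less[OF R] depth_Suc_cong[OF R gr(1)] by (simp add: S_def)
  qed (simp add: S_def)
  then obtain f where f: "f ` S \<subseteq> X" "\<forall>x \<in> S. \<forall>y \<in> S. (x, y) \<in> R \<longrightarrow> (f x, f y) \<in> Restr E X" by blast
  \<comment> \<open>\<open>N\<close> bounds the heights outside \<open>S\<close>; subtracting
    heights from it gives levels that increase along arcs.\<close>
  define N where "N = card Y - 1"
  have le: "depth (R\<inverse>) v \<le> N" if "v \<notin> S" for v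
  proof (cases "v \<in> Domain R")
    case True
    then show ?thesis using that height[of v] card by (simp add: S_def N_def)
  next
    case False
    then show ?thesis using depth_source[OF R', of v] by simp
  qed
  have "\<exists>f. f ` (- S) \<subseteq> Y \<and> (\<forall>x \<in> - S. \<forall>y \<in> - S. (x, y) \<in> R \<longrightarrow> (f x, f y) \<in> Restr E Y)"
  proof (intro graded_hom[where lv = "\<lambda>v. N - depth (R\<inverse>) v" and l = l] tournament_on_Restr[OF T(1)] l)
    show "Y \<subseteq> V" using XY(4) by blast
  next
    fix x y assume xy: "x \<in> - S" "y \<in> - S" "(x, y) \<in> R"
    let ?hx = "depth (R\<inverse>) x" and ?hy = "depth (R\<inverse>) y"
    have lt: "?hy < ?hx" using depth_less[OF R', of y x] xy by simp
    have xN: "?hx \<le> N" using le xy by simp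
    \<comment> \<open>As \<open>x\<close> is no sink, only its depth can have kept it out of
      \<open>S\<close>; this depth is positive, so \<open>x\<close> is inner and its height is
      graded.\<close>
    have "x \<in> Domain R" using xy(3) by blast
    then have "card X \<le> depth R x" using xy(1) by (simp add: S_def)
    then have "depth R x \<noteq> 0" using card(2) by linarith
    then have "x \<in> Range R" by (rule contrapos_np) (rule depth_source[OF R])
    then have "[?hx = Suc ?hy] (mod l)" using depth_Suc_cong[OF R' gr(2)] xy by blast
    then have "[N + ?hx = N + Suc ?hy] (mod l)" by (intro cong_add cong_refl)
    \<comment> \<open>Adding both heights to each side removes the truncated subtractions.\<close>
    moreover have "N + ?hx = (N - ?hy) + (?hx + ?hy)" "N + Suc ?hy = Suc (N - ?hx) + (?hx + ?hy)"
      using lt xN by simp_all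
    ultimately have "[N - ?hy = Suc (N - ?hx)] (mod l)" by (metis cong_add_rcancel_nat)
    then show "N - ?hx < N - ?hy \<and> [N - ?hy = Suc (N - ?hx)] (mod l)" using lt xN by simp
  next
    fix x show "N - depth (R\<inverse>) x < card Y" using card(3) by (simp add: N_def)
  qed
  then obtain g where g: "g ` (- S) \<subseteq> Y"
    "\<forall>x \<in> - S. \<forall>y \<in> - S. (x, y) \<in> R \<longrightarrow> (g x, g y) \<in> Restr E Y" by blast
  define h where "h x = (if x \<in> S then f x else g x)" for x
  have "(h x, h y) \<in> E" if xy: "(x, y) \<in> R" for x y
  proof -
    \<comment> \<open>A predecessor is never a sink and has smaller depth, so no arc enters
      \<open>S\<close> from outside.\<close>
    have "x \<in> S" if "y \<in> S" using that xy depth_less[OF R xy] by (auto simp: S_def)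
    then consider "x \<in> S" "y \<in> S" | "x \<notin> S" "y \<notin> S" | "x \<in> S" "y \<notin> S" by blast
    then show ?thesis
    proof cases
      case 3
      then have "(f x, g y) \<in> X \<times> Y" using f(1) g(1) by blast
      then show ?thesis using 3 XY(5) unfolding h_def by auto
    qed (use xy f(2) g(2) in \<open>auto simp: h_def\<close>)
  qed
  moreover have "range h \<subseteq> V" using f(1) g(1) XY(4) unfolding h_def by auto
  ultimately show ?thesis by blast
qed

section \<open>From digraphs to relations: paths, layers and longest paths\<close>

lemma relpow_converse: "((R :: 'a rel)\<inverse>) ^^ n = (R ^^ n)\<inverse>"
proof (induction n)
  case (Suc n)
  have "R\<inverse> ^^ Suc n = R\<inverse> O R\<inverse> ^^ n" by (simp add: relpow_commute)
  then show ?case by (simp add: Suc converse_relcomp)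
qed simp

text \<open>Acyclicity makes every walk a path. The induction also records that \<open>u\<close>
  reaches every vertex of \<open>p\<close>, so a repeated vertex would close a cycle.\<close>

lemma path_of_relpow:
  assumes "pair_wf_digraph H" "acyclic (parcs H)"
    and "(u, v) \<in> parcs H ^^ n" "v \<in> pverts H"
  shows "\<exists>p. vpath p H \<and> hd p = u \<and> last p = v \<and> length p = Suc n"
proof -
  interpret pair_wf_digraph H by fact
  have "\<exists>p. vpath p H \<and> hd p = u \<and> last p = v \<and> length p = Suc n \<and>
      (\<forall>x \<in> set p. (u, x) \<in> (parcs H)\<^sup>*)"
    using assms(3)
  proof (induction n arbitrary: u)
    case 0
    then show ?case using assms(4) by (intro exI[of _ "[v]"]) (auto simp: vpath_def vwalk_def)
  next
    case (Suc n)
    obtain x where ux: "(u, x) \<in> parcs H" and xv: "(x, v) \<in> parcs H ^^ n"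
      using Suc.prems by (rule relpow_Suc_E2)
    obtain p where p: "vpath p H" "hd p = x" "last p = v" "length p = Suc n"
      "\<forall>y \<in> set p. (x, y) \<in> (parcs H)\<^sup>*"
      using Suc.IH[OF xv] by blast
    have "u \<notin> set p"
      using p(5) ux assms(2) unfolding acyclic_def by (meson rtrancl_into_trancl2)
    moreover have "vwalk (u # p) H"
      using p ux in_arcsD1[OF ux] by (intro vwalk_consI) (auto simp: vpath_def)
    ultimately have "vpath (u # p) H" using p(1) by (simp add: vpath_def)
    moreover have "(u, y) \<in> (parcs H)\<^sup>*" if "y \<in> set (u # p)" for y
      using that p(5) ux by (auto intro: converse_rtrancl_into_rtrancl)
    ultimately show ?case using p by (intro exI[of _ "u # p"]) auto
  qed
  then show ?thesis by blast
qed

lemma relpow_of_walk: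
  fixes H :: "'a pair_pre_digraph"
  assumes "vwalk p H"
  shows "(hd p, last p) \<in> parcs H ^^ (length p - 1)"
  using assms
proof (induction p rule: vwalk_induct)
  case (Cons u v es)
  then have "(v, last (v # es)) \<in> parcs H ^^ length es" by simp
  with Cons have "(u, last (v # es)) \<in> parcs H ^^ Suc (length es)"
    by (intro relpow_Suc_I2[of u v]) simp_all
  then show ?case by simp
qed simp

lemma hom_relpow:
  assumes "\<And>x y. (x, y) \<in> R \<Longrightarrow> (f x, f y) \<in> E" "(x, y) \<in> R ^^ n"
  shows "(f x, f y) \<in> E ^^ n"
  using assms(2) by (induction n arbitrary: y) (auto intro: assms(1) elim!: relpow_Suc_E)

lemma finite_vpath_lengths:
  fixes H :: "'a pair_pre_digraph"
  assumes "finite (pverts H)"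
  shows "finite (length ` {p. vpath p H})"
proof -
  have "length p \<le> card (pverts H)" if "vpath p H" for p
  proof -
    have "set p \<subseteq> pverts H" "distinct p" using that by (auto simp: vpath_def vwalk_def)
    then show ?thesis using card_mono[OF assms] distinct_card by metis
  qed
  then have "length ` {p. vpath p H} \<subseteq> {..card (pverts H)}" by blast
  then show ?thesis by (rule finite_subset) simp
qed

lemma vpath_length_le:
  fixes H :: "'a pair_pre_digraph"
  assumes "finite (pverts H)" "vpath p H"
  shows "length p \<le> longest_path_order H"
  unfolding longest_path_order_def
  using assms finite_vpath_lengths by (intro cSUP_upper) (simp_all add: bdd_above_nat)

lemma longest_vpath:
  fixes H :: "'a pair_pre_digraph"
  assumes "finite (pverts H)" "longest_path_order H > 0"
  obtains p where "vpath p H" "length p = longest_path_order H"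
proof -
  \<comment> \<open>Without any path the supremum would be 0, against the positivity
    assumption.\<close>
  have "length ` {p. vpath p H} \<noteq> {}"
    using assms(2) unfolding longest_path_order_def by (auto simp: Sup_nat_def split: if_splits)
  then have "longest_path_order H \<in> length ` {p. vpath p H}"
    unfolding longest_path_order_def Sup_nat_def
    using finite_vpath_lengths[OF assms(1)] by (simp only: if_False) (rule Max_in)
  then show thesis using that by force
qed

text \<open>Walks from sources and to sinks are turned into vertex paths, to which
  \<open>layered\<close> applies; the condition on sinks becomes one on sources of the
  converse.\<close>

lemma layered_source_graded:
  assumes H: "oriented_graph H" "acyclic (parcs H)" "layered l H"
  shows "source_graded l (parcs H)" "source_graded l ((parcs H)\<inverse>)"
proof -
  interpret oriented_graph H by fact
  have wf: "pair_wf_digraph H" by unfold_locales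
  have src: "is_source H v \<longleftrightarrow> v \<in> pverts H \<and> v \<notin> Range (parcs H)" for v
    by (auto simp: is_source_def)
  have snk: "is_sink H v \<longleftrightarrow> v \<in> pverts H \<and> v \<notin> Domain (parcs H)" for v
    by (auto simp: is_sink_def)
  have start: "u \<in> pverts H" if "(u, v) \<in> parcs H ^^ n" "v \<in> pverts H" for u v n
    using that by (cases n) (auto simp del: relpow.simps(2) dest: in_arcsD1 elim!: relpow_Suc_E2)
  have finish: "v \<in> pverts H" if "(u, v) \<in> parcs H ^^ n" "u \<in> pverts H" for u v n
    using that by (cases n) (auto dest: in_arcsD2)
  have grades: "\<exists>i j. (\<forall>u n. u \<notin> Range (parcs H) \<and> (u, v) \<in> parcs H ^^ n \<longrightarrow> [n = i] (mod l)) \<and>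
      (\<forall>u n. u \<notin> Domain (parcs H) \<and> (v, u) \<in> parcs H ^^ n \<longrightarrow> [n = j] (mod l))"
    if v: "v \<in> Domain (parcs H) \<inter> Range (parcs H)" for v
  proof -
    have vH: "v \<in> pverts H" using v in_arcsD1 by blast
    have "\<not> is_sink H v \<and> \<not> is_source H v" using v unfolding src snk by blast
    then obtain i j where
      i: "\<forall>p. vpath p H \<and> is_source H (hd p) \<and> last p = v \<longrightarrow> [vwalk_length p = i] (mod l)" and
      j: "\<forall>p. vpath p H \<and> hd p = v \<and> is_sink H (last p) \<longrightarrow> [vwalk_length p = j] (mod l)"
      using bspec[OF H(3)[unfolded layered_def] vH] by (elim impE exE conjE) auto
    have "[n = i] (mod l)" if u: "u \<notin> Range (parcs H)" "(u, v) \<in> parcs H ^^ n" for u n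
    proof -
      obtain p where "vpath p H" "hd p = u" "last p = v" "length p = Suc n"
        using path_of_relpow[OF wf H(2) u(2) vH] by blast
      then show ?thesis using i[rule_format, of p] src start[OF u(2) vH] u(1) by simp
    qed
    moreover have "[n = j] (mod l)" if u: "u \<notin> Domain (parcs H)" "(v, u) \<in> parcs H ^^ n" for u n
    proof -
      have "u \<in> pverts H" using finish[OF u(2) vH] .
      then obtain p where "vpath p H" "hd p = v" "last p = u" "length p = Suc n"
        using path_of_relpow[OF wf H(2) u(2)] by blast
      then show ?thesis using j[rule_format, of p] snk \<open>u \<in> pverts H\<close> u(1) by simp
    qed
    ultimately show ?thesis by blast
  qed
  show "source_graded l (parcs H)" unfolding source_graded_def using grades by meson
  show "source_graded l ((parcs H)\<inverse>)"
    unfolding source_graded_def relpow_converse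
    using grades by (simp only: Domain_converse Range_converse converse_iff) (meson IntD1 IntD2 IntI)
qed

text \<open>A longest walk into \<open>v\<close> joined to a longest walk out of \<open>v\<close> is
  a path, with one more vertex than arcs.\<close>

lemma depth_sum_less_longest_path_order:
  assumes H: "oriented_graph H" "acyclic (parcs H)" and pos: "longest_path_order H > 0"
  shows "depth (parcs H) v + depth ((parcs H)\<inverse>) v < longest_path_order H"
proof -
  interpret oriented_graph H by fact
  let ?R = "parcs H"
  have wf: "pair_wf_digraph H" by unfold_locales
  have R: "finite ?R" "acyclic ?R" "finite (?R\<inverse>)" "acyclic (?R\<inverse>)"
    using pair_finite_arcs H(2) by simp_all
  obtain u where u: "(u, v) \<in> ?R ^^ depth ?R v" by (rule depth_walk[OF R(1,2)])
  obtain w where "(w, v) \<in> (?R\<inverse>) ^^ depth (?R\<inverse>) v" by (rule depth_walk[OF R(3,4)])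
  then have "(v, w) \<in> ?R ^^ depth (?R\<inverse>) v" by (simp add: relpow_converse)
  with u have uw: "(u, w) \<in> ?R ^^ (depth ?R v + depth (?R\<inverse>) v)" (is "_ \<in> ?R ^^ ?n")
    by (rule relpow_trans)
  show ?thesis
  \<comment> \<open>If \<open>v\<close> is not a vertex, both depths are 0 and there is no path to
    compare with; \<open>pos\<close> settles this case.\<close>
  proof (cases "?n = 0")
    case True
    then show ?thesis using pos by simp
  next
    case False
    then have "w \<in> pverts H" using uw by (cases ?n) (auto dest: in_arcsD2)
    then obtain p where "vpath p H" "length p = Suc ?n"
      using path_of_relpow[OF wf H(2) uw] by blast
    then show ?thesis using vpath_length_le[OF pair_finite_verts] by fastforce
  qed
qed

lemma tournament_on_of_tournament:
  assumes "tournament T"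
  shows "tournament_on (pverts T) (parcs T)"
proof -
  interpret tournament T by fact
  show ?thesis
    unfolding tournament_on_def
  proof (intro conjI ballI)
    show "parcs T \<subseteq> pverts T \<times> pverts T" using in_arcsD1 in_arcsD2 by auto
    show "(u, v) \<in> parcs T \<longleftrightarrow> u \<noteq> v \<and> (v, u) \<notin> parcs T" if "u \<in> pverts T" "v \<in> pverts T" for u v
      using complete[OF that] at_most_one_arc[of u v] at_most_one_arc[of u u] by blast
  qed (rule pair_finite_verts)
qed

section \<open>The lower bound from transitive tournaments\<close>

definition transitive_tournament :: "nat \<Rightarrow> nat pair_pre_digraph" where
  "transitive_tournament k = \<lparr>pverts = {..<k}, parcs = {(i, j). i < j \<and> j < k}\<rparr>"

lemma tournament_transitive_tournament: "tournament (transitive_tournament k)"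
proof -
  have "finite {(i, j). i < j \<and> j < k}"
    by (rule finite_subset[of _ "{..<k} \<times> {..<k}"]) auto
  then show ?thesis by unfold_locales (auto simp: transitive_tournament_def)
qed

lemma transitive_tournament_relpow:
  "(i, j) \<in> parcs (transitive_tournament k) ^^ n \<Longrightarrow> i + n \<le> j"
  by (induction n arbitrary: j)
    (auto simp: transitive_tournament_def elim!: relpow_Suc_E dest!: less_imp_Suc_add, fastforce)

text \<open>The image of a longest path gains at least one label per arc, yet must end at a label
  below \<open>k\<close>.\<close>

lemma longest_path_order_le_of_hom:
  assumes "finite (pverts H)" "longest_path_order H > 0"
    and f: "digraph_hom f H (transitive_tournament k)"
  shows "longest_path_order H \<le> k"
proof -
  obtain p where p: "vpath p H" "length p = longest_path_order H"
    using longest_vpath[OF assms(1,2)] .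
  have "(f (hd p), f (last p)) \<in> parcs (transitive_tournament k) ^^ (length p - 1)"
    using f p(1) by (intro hom_relpow[OF _ relpow_of_walk]) (auto simp: digraph_hom_def vpath_def)
  then have "length p - 1 \<le> f (last p)" using transitive_tournament_relpow by fastforce
  moreover have "last p \<in> pverts H"
    using p(1) last_in_set[of p] by (auto simp: vpath_def vwalk_def)
  then have "f (last p) < k" using f by (auto simp: digraph_hom_def transitive_tournament_def)
  ultimately show ?thesis using p(2) by linarith
qed

theorem theorem23:
  fixes l :: nat and H :: "'a pair_pre_digraph"
  assumes "l \<ge> 3"
    and "oriented_graph H"
    and "acyclic (parcs H)"
    and "layered l H"
    and "longest_path_order H \<ge> 6"
  shows "compressibility H = enat (longest_path_order H)"
proof -
  interpret oriented_graph H by fact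
  have pos: "longest_path_order H > 0" using assms(5) by simp
  have "\<exists>f. digraph_hom f H T"
    if T: "tournament T" "card (pverts T) = longest_path_order H" for T :: "nat pair_pre_digraph"
  proof -
    \<comment> \<open>The map is defined on the whole type, isolated vertices included, so the arc
      relation of \<open>H\<close> is all that has to be passed on.\<close>
    have "\<exists>f. range f \<subseteq> pverts T \<and> (\<forall>x y. (x, y) \<in> parcs H \<longrightarrow> (f x, f y) \<in> parcs T)"
      using layered_source_graded[OF assms(2,3,4)] depth_sum_less_longest_path_order[OF assms(2,3) pos]
        pair_finite_arcs assms T
      by (intro hom_into_tournament[where l = l] tournament_on_of_tournament) simp_all
    then show ?thesis unfolding digraph_hom_def by (meson image_mono subset_UNIV subset_trans)
  qed
  moreover have "longest_path_order H \<le> k"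
    if k: "\<forall>T :: nat pair_pre_digraph. tournament T \<and> card (pverts T) = k \<longrightarrow> (\<exists>f. digraph_hom f H T)"
    for k
  proof -
    have "card (pverts (transitive_tournament k)) = k" by (simp add: transitive_tournament_def)
    then obtain f where "digraph_hom f H (transitive_tournament k)"
      using k tournament_transitive_tournament by blast
    then show ?thesis using longest_path_order_le_of_hom[OF pair_finite_verts pos] by blast
  qed
  ultimately show ?thesis
    unfolding compressibility_def by (intro antisym Inf_lower Inf_greatest) auto
qed

end
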